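(* Let $G$ be a graph and let $I=I(G)$ be its edge ideal. Then the function $t\mapsto\dim I^{(t)}/I^t$ is non-decreasing in $t\ge1$.
   Context: A graph on the vertex set $[n]=\{1,\dots,n\}$ always means a simple (no loops, no multiple edges) connected graph. Its edge ideal is $I(G)=(x_ix_j : \{i,j\}\in E(G))\subseteq S=k[x_1,\dots,x_n]$, $k$ an arbitrary field. The $t$-th symbolic power of an ideal $I$ is $I^{(t)}=\bigcap_{\mathfrak p\in\mathrm{Ass}(I)}(I^tS_{\mathfrak p}\cap S)$. By convention the zero module has dimension $-1$. *)

theory Defs
  imports
    "HOL-Library.Poly_Mapping"
    "HOL-Library.Extended_Real"
    "HOL-Computational_Algebra.Fraction_Field"
    "Graph_Theory.Graph_Theory"
    "HOL-Algebra.Algebraic_Closure_Type"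
    "HOL-Algebra.Algebra"
begin

section \<open>Dimension and associated primes of modules\<close>

definition annihilator :: "('a, 'c) ring_scheme \<Rightarrow> ('a, 'b) module \<Rightarrow> 'a set" where
  "annihilator R M = {r \<in> carrier R. \<forall>m \<in> carrier M. r \<odot>\<^bsub>M\<^esub> m = \<zero>\<^bsub>M\<^esub>}"

definition associated_primes :: "('a, 'c) ring_scheme \<Rightarrow> ('a, 'b) module \<Rightarrow> 'a set set" where
  "associated_primes R M =
     {P. primeideal P R \<and> (\<exists>m \<in> carrier M. P = {r \<in> carrier R. r \<odot>\<^bsub>M\<^esub> m = \<zero>\<^bsub>M\<^esub>})}"

text \<open>A chain \<open>P\<^sub>0 \<subset> \<dots> \<subset> P\<^sub>d\<close> of primes is represented by the set of its \<open>d + 1\<close> members.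
  The values are extended reals so that the supremum exists for every ring.\<close>

definition krull_dim :: "('a, 'c) ring_scheme \<Rightarrow> ereal" where
  "krull_dim R =
     (SUP C \<in> {C. finite C \<and> C \<noteq> {} \<and> subset.chain {P. primeideal P R} C}.
        ereal (real (card C) - 1))"

text \<open>The Krull dimension of a finitely generated module is that of the ring modulo its
  annihilator; the zero module is given dimension \<open>- 1\<close>.\<close>

definition module_dim :: "('a, 'c) ring_scheme \<Rightarrow> ('a, 'b) module \<Rightarrow> ereal" where
  "module_dim R M =
     (if carrier M = {\<zero>\<^bsub>M\<^esub>} then - 1 else krull_dim (R Quot annihilator R M))"

text \<open>The \<open>R\<close>-module \<open>N/L\<close> for ideals \<open>L \<subseteq> N\<close> of \<open>R\<close>. The fields \<open>mult\<close> and \<open>one\<close>, which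
  the record type of modules inherits from rings, play no role.\<close>

definition ideal_quotient ::
    "('a, 'c) ring_scheme \<Rightarrow> 'a set \<Rightarrow> 'a set \<Rightarrow> ('a, 'a set) module" where
  "ideal_quotient R N L =
     \<lparr>carrier = (\<lambda>x. L +>\<^bsub>R\<^esub> x) ` N,
      mult = rcoset_mult R L, one = L +>\<^bsub>R\<^esub> \<one>\<^bsub>R\<^esub>,
      ring.zero = L, add = set_add R,
      module.smult = (\<lambda>r A. \<Union>x \<in> A. L +>\<^bsub>R\<^esub> (r \<otimes>\<^bsub>R\<^esub> x))\<rparr>"


section \<open>Symbolic powers\<close>

definition ideal_power :: "('a, 'c) ring_scheme \<Rightarrow> 'a set \<Rightarrow> nat \<Rightarrow> 'a set" where
  "ideal_power R I t = I [^]\<^bsub>ideals_set R\<^esub> t"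

text \<open>From here on, \<open>R\<close> is a subring of the integral domain \<open>'a\<close> (that is,
  \<^const>\<open>ring_of_type_algebra\<close> with a smaller carrier), and the localization \<open>R\<^sub>P\<close> is the
  subring of fractions with denominator outside \<open>P\<close> in the fraction field of \<open>'a\<close>.\<close>

definition localization :: "'a::idom ring \<Rightarrow> 'a set \<Rightarrow> 'a fract ring" where
  "localization R P =
     ring_of_type_algebra\<lparr>carrier := {Fract a s | a s. a \<in> carrier R \<and> s \<in> carrier R - P}\<rparr>"

definition extension :: "'a::idom ring \<Rightarrow> 'a set \<Rightarrow> 'a set \<Rightarrow> 'a fract set" where
  "extension R P J = genideal (localization R P) ((\<lambda>a. Fract a 1) ` J)"

definition contraction :: "'a::idom ring \<Rightarrow> 'a fract set \<Rightarrow> 'a set" where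
  "contraction R K = {a \<in> carrier R. Fract a 1 \<in> K}"

text \<open>As usual for ideals, \<open>Ass(I)\<close> stands for the associated primes of the module \<open>R/I\<close>.\<close>

definition symbolic_power :: "'a::idom ring \<Rightarrow> 'a set \<Rightarrow> nat \<Rightarrow> 'a set" where
  "symbolic_power R I t =
     carrier R \<inter> (\<Inter>P \<in> associated_primes R (ideal_quotient R (carrier R) I).
       contraction R (extension R P (ideal_power R I t)))"


section \<open>Polynomial rings and edge ideals\<close>

text \<open>A polynomial maps each monomial, given by its exponent vector, to its coefficient.\<close>

type_synonym 'k mpoly = "(nat \<Rightarrow>\<^sub>0 nat) \<Rightarrow>\<^sub>0 'k"

definition mpoly_ring :: "nat \<Rightarrow> 'k::field mpoly ring" where
  "mpoly_ring n =
     ring_of_type_algebra\<lparr>carrier :=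
       {p. \<forall>m \<in> Poly_Mapping.keys p. Poly_Mapping.keys m \<subseteq> {1..n}}\<rparr>"

definition indet :: "nat \<Rightarrow> 'k::field mpoly" where
  "indet i = Poly_Mapping.single (Poly_Mapping.single i 1) 1"

text \<open>An undirected edge \<open>{i, j}\<close> of a \<^const>\<open>pair_graph\<close> is the pair of arcs
  \<open>(i, j)\<close>, \<open>(j, i)\<close>, which give the same generator.\<close>

definition edge_ideal :: "nat \<Rightarrow> nat pair_pre_digraph \<Rightarrow> 'k::field mpoly set" where
  "edge_ideal n G = genideal (mpoly_ring n) {indet i * indet j | i j. (i, j) \<in> parcs G}"

end

theory Submission
  imports Defs
begin

text \<open>Write \<open>M\<^sub>t\<close> for \<open>I\<^sup>(\<^sup>t\<^sup>) / I\<^sup>t\<close>. The dimension can only grow with \<open>t\<close> because the annihilators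
  shrink: \<open>Ann M\<^sub>t\<^sub>+\<^sub>1 \<subseteq> Ann M\<^sub>t\<close>. Indeed \<open>I\<^sup>(\<^sup>t\<^sup>) I \<subseteq> I\<^sup>(\<^sup>t\<^sup>+\<^sup>1\<^sup>)\<close>, so if \<open>r\<close> maps \<open>I\<^sup>(\<^sup>t\<^sup>+\<^sup>1\<^sup>)\<close> into
  \<open>I\<^sup>t\<^sup>+\<^sup>1\<close>, then \<open>r I\<^sup>(\<^sup>t\<^sup>)\<close> lies in \<open>(I\<^sup>t\<^sup>+\<^sup>1 : I)\<close>, and for an edge ideal of a graph with at least
  one edge this colon ideal is \<open>I\<^sup>t\<close> (\<open>colon_ideal_power\<close>, a result of Martinez-Bernal, Morey and
  Villarreal). If there is no edge, all \<open>M\<^sub>t\<close> vanish. The inclusion of annihilators also shows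
  that \<open>M\<^sub>t\<close> vanishes when \<open>M\<^sub>t\<^sub>+\<^sub>1\<close> does, which covers the dimension \<open>- 1\<close>
  (\<open>module_dim_mono_colon\<close>).

  As \<open>I\<^sup>t\<close> is a monomial ideal, the equality of \<open>(I\<^sup>t\<^sup>+\<^sup>1 : I)\<close> and \<open>I\<^sup>t\<close> is a statement on graphs: if for
  every edge \<open>e\<close> the monomial \<open>x\<^sup>a e\<close> is divisible by a product of \<open>t + 1\<close> edges, then \<open>x\<^sup>a\<close> is
  divisible by a product of \<open>t\<close> edges (\<open>packs_colon\<close>). Edges may be repeated in such a product,
  so it is a matching in the graph in which each vertex \<open>v\<close> has been replaced by \<open>a\<^sub>v\<close> copies, and
  the statement could be read off from the Gallai-Edmonds decomposition of that graph. The proof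
  here is direct. It rests on the exchange property of degree sequences (\<open>exchange\<close>),
  which replaces the augmenting paths of matching theory and makes the copies of vertices
  superfluous.\<close>

section \<open>Packing edges under a degree bound\<close>

text \<open>Degrees are integers so that differences of degree functions can be formed.\<close>

definition edge_deg :: "('v \<times> 'v) multiset \<Rightarrow> 'v \<Rightarrow> int" where
  "edge_deg M v = (\<Sum>(x, y)\<in>#M. of_bool (x = v) + of_bool (y = v))"

lemma edge_deg_empty [simp]: "edge_deg {#} v = 0"
  by (simp add: edge_deg_def)

lemma edge_deg_add_mset [simp]:
  "edge_deg (add_mset (x, y) M) v = of_bool (x = v) + of_bool (y = v) + edge_deg M v"
  by (simp add: edge_deg_def)

lemma edge_deg_union [simp]: "edge_deg (M + N) v = edge_deg M v + edge_deg N v"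
  by (simp add: edge_deg_def)

lemma edge_deg_diff: "N \<subseteq># M \<Longrightarrow> edge_deg (M - N) v = edge_deg M v - edge_deg N v"
  by (metis add_diff_cancel_right' edge_deg_union subset_mset.diff_add)

lemma edge_deg_nonneg [simp]: "0 \<le> edge_deg M v"
  by (induction M) auto

lemma edge_at_vertex:
  assumes "0 < edge_deg M u"
  obtains w e M' where "M = add_mset e M'" "e = (u, w) \<or> e = (w, u)"
proof -
  have "\<exists>e \<in># M. fst e = u \<or> snd e = u"
    using assms by (induction M) (auto simp: of_bool_def split: if_splits)
  then obtain e where e: "e \<in># M" "fst e = u \<or> snd e = u" by blast
  show ?thesis
    using that[of e "M - {#e#}"] e by (cases e) auto
qed

text \<open>The degrees of \<open>P\<close> exceed those of \<open>Q\<close> at \<open>u\<close>, so a walk can leave \<open>u\<close> along an edge of \<open>P\<close>,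
  continue along an edge of \<open>Q\<close>, and alternate from there on. It is stopped as soon as it has used
  an edge of \<open>P\<close> (\<open>Q\<close>) to enter a vertex \<open>v\<close> where \<open>P\<close> (\<open>Q\<close>) has the larger degree, the edges used
  before the last one not counted; until then the degree balance at the current vertex guarantees
  an edge to continue. On the edges used, the degrees of \<open>P\<close> and \<open>Q\<close> cancel except at the two
  ends of the walk. The strict inequality with \<open>of_bool (v = u)\<close> says that a closed walk of odd
  length uses up an excess of at least \<open>2\<close> at \<open>u\<close>.\<close>

lemma alternating_walk:
  assumes "edge_deg Q u < edge_deg P u" and "\<And>x. (x, x) \<notin># P"
  shows "\<exists>v P' Q'. P' \<subseteq># P \<and> Q' \<subseteq># Q \<and>
    (size P' = Suc (size Q') \<and> of_bool (v = u) < edge_deg P v - edge_deg Q v \<and>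
       (\<forall>w. edge_deg P' w - edge_deg Q' w = of_bool (u = w) + of_bool (v = w))
     \<or> size P' = size Q' \<and> edge_deg P v < edge_deg Q v \<and>
       (\<forall>w. edge_deg P' w - edge_deg Q' w = of_bool (u = w) - of_bool (v = w)))"
  using assms
proof (induction "size P" arbitrary: P Q u rule: less_induct)
  case less
  have "0 < edge_deg P u"
    using less.prems(1) edge_deg_nonneg[of Q u] by linarith
  then obtain w e P1 where P: "P = add_mset e P1" and e: "e = (u, w) \<or> e = (w, u)"
    by (rule edge_at_vertex)
  have uw: "u \<noteq> w" using less.prems(2) P e by auto
  have degP: "edge_deg P v = of_bool (u = v) + of_bool (w = v) + edge_deg P1 v" for v
    using P e by auto
  show ?case
  proof (cases "edge_deg Q w < edge_deg P w")
    case True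
    show ?thesis
      by (rule exI[of _ w], rule exI[of _ "{#e#}"], rule exI[of _ "{#}"])
        (use True uw e P in auto)
  next
    case False
    have "edge_deg P w = 1 + edge_deg P1 w" using degP[of w] uw by simp
    then have "0 < edge_deg Q w" using False edge_deg_nonneg[of P1 w] by linarith
    then obtain z f Q1 where Q: "Q = add_mset f Q1" and f: "f = (w, z) \<or> f = (z, w)"
      by (rule edge_at_vertex)
    have degQ: "edge_deg Q v = of_bool (w = v) + of_bool (z = v) + edge_deg Q1 v" for v
      using Q f by auto
    show ?thesis
    proof (cases "edge_deg P z < edge_deg Q z")
      case True
      show ?thesis
        by (rule exI[of _ z], rule exI[of _ "{#e#}"], rule exI[of _ "{#f#}"])
          (use True e f P Q in auto)
    next
      case F: False
      \<comment> \<open>The walk goes on from \<open>z\<close>: the edge of \<open>Q\<close> that led to \<open>z\<close> is removed, which makes the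
        balance at \<open>z\<close> positive.\<close>
      have lt: "edge_deg Q1 z < edge_deg P1 z"
        using F degP[of z] degQ[of z] less.prems(1) uw by (auto simp: of_bool_def split: if_splits)
      have "size P1 < size P" "\<And>x. (x, x) \<notin># P1"
        using P less.prems(2) by auto
      from less.hyps[OF this(1) lt this(2)] obtain v P' Q' where sub: "P' \<subseteq># P1" "Q' \<subseteq># Q1" and
        *: "size P' = Suc (size Q') \<and> of_bool (v = z) < edge_deg P1 v - edge_deg Q1 v \<and>
             (\<forall>w. edge_deg P' w - edge_deg Q' w = of_bool (z = w) + of_bool (v = w))
           \<or> size P' = size Q' \<and> edge_deg P1 v < edge_deg Q1 v \<and>
             (\<forall>w. edge_deg P' w - edge_deg Q' w = of_bool (z = w) - of_bool (v = w))"
        by blast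
      have dP': "edge_deg (add_mset e P') x = of_bool (u = x) + of_bool (w = x) + edge_deg P' x" for x
        using e by auto
      have dQ': "edge_deg (add_mset f Q') x = of_bool (w = x) + of_bool (z = x) + edge_deg Q' x" for x
        using f by auto
      show ?thesis
      proof (rule exI[of _ v], rule exI[of _ "add_mset e P'"], rule exI[of _ "add_mset f Q'"],
          intro conjI)
        show "add_mset e P' \<subseteq># P" "add_mset f Q' \<subseteq># Q"
          using sub P Q by auto
        show "size (add_mset e P') = Suc (size (add_mset f Q')) \<and>
            of_bool (v = u) < edge_deg P v - edge_deg Q v \<and>
            (\<forall>x. edge_deg (add_mset e P') x - edge_deg (add_mset f Q') x = of_bool (u = x) + of_bool (v = x))
          \<or> size (add_mset e P') = size (add_mset f Q') \<and> edge_deg P v < edge_deg Q v \<and>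
            (\<forall>x. edge_deg (add_mset e P') x - edge_deg (add_mset f Q') x = of_bool (u = x) - of_bool (v = x))"
          using *
        proof (elim disjE conjE, goal_cases)
          case 1
          have "of_bool (v = u) < edge_deg P v - edge_deg Q v"
            using 1 degP[of v] degQ[of v] uw F less.prems(1)
            by (auto simp: of_bool_def split: if_splits)
          then show ?case using 1 unfolding dP' dQ' by (auto simp: algebra_simps)
        next
          case 2
          have "edge_deg P v < edge_deg Q v"
            using 2 degP[of v] degQ[of v] uw lt less.prems(1)
            by (auto simp: of_bool_def split: if_splits)
          then show ?case using 2 unfolding dP' dQ' by (auto simp: algebra_simps)
        qed
      qed
    qed
  qed
qed

text \<open>The simultaneous exchange property of the degree sequences of edge multisets: exchanging the
  edges of an alternating walk between \<open>M\<close> and \<open>N\<close> moves both degree functions towards each other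
  at the two ends of the walk and nowhere else.\<close>

lemma exchange:
  assumes "set_mset M \<subseteq> E" "set_mset N \<subseteq> E" "irrefl E" and less: "edge_deg M u < edge_deg N u"
  obtains (join) v M' N' where "set_mset M' \<subseteq> E" "set_mset N' \<subseteq> E"
      "size M' = Suc (size M)" "size N = Suc (size N')" "of_bool (v = u) < edge_deg N v - edge_deg M v"
      "\<And>w. edge_deg M' w = edge_deg M w + of_bool (u = w) + of_bool (v = w)"
      "\<And>w. edge_deg N' w = edge_deg N w - of_bool (u = w) - of_bool (v = w)"
  | (move) v M' N' where "set_mset M' \<subseteq> E" "set_mset N' \<subseteq> E"
      "size M' = size M" "size N = size N'" "edge_deg N v < edge_deg M v"
      "\<And>w. edge_deg M' w = edge_deg M w + of_bool (u = w) - of_bool (v = w)"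
      "\<And>w. edge_deg N' w = edge_deg N w - of_bool (u = w) + of_bool (v = w)"
proof -
  have "(x, x) \<notin># N" for x
    using assms(2,3) by (auto simp: irrefl_def)
  from alternating_walk[OF less this] obtain v P Q where sub: "P \<subseteq># N" "Q \<subseteq># M" and
    *: "size P = Suc (size Q) \<and> of_bool (v = u) < edge_deg N v - edge_deg M v \<and>
          (\<forall>w. edge_deg P w - edge_deg Q w = of_bool (u = w) + of_bool (v = w))
        \<or> size P = size Q \<and> edge_deg N v < edge_deg M v \<and>
          (\<forall>w. edge_deg P w - edge_deg Q w = of_bool (u = w) - of_bool (v = w))"
    by blast
  define M' N' where "M' = M - Q + P" and "N' = N - P + Q"
  have E: "set_mset M' \<subseteq> E" "set_mset N' \<subseteq> E"
    using assms(1,2) set_mset_mono[OF sub(1)] set_mset_mono[OF sub(2)]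
    unfolding M'_def N'_def set_mset_union by (meson Un_least diff_subset_eq_self set_mset_mono subset_trans)+
  have d: "edge_deg M' w = edge_deg M w + (edge_deg P w - edge_deg Q w)"
    "edge_deg N' w = edge_deg N w - (edge_deg P w - edge_deg Q w)" for w
    unfolding M'_def N'_def edge_deg_union edge_deg_diff[OF sub(1)] edge_deg_diff[OF sub(2)] by simp_all
  have s: "size M' + size Q = size M + size P" "size N' + size P = size N + size Q"
    using size_mset_mono[OF sub(1)] size_mset_mono[OF sub(2)]
    unfolding M'_def N'_def size_union size_Diff_submset[OF sub(1)] size_Diff_submset[OF sub(2)]
    by simp_all
  from * show ?thesis
  proof (elim disjE conjE, goal_cases)
    case 1
    show ?thesis by (rule join[of M' N' v]) (use 1 E d s in auto)
  next
    case 2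
    show ?thesis by (rule move[of M' N' v]) (use 2 E d s in auto)
  qed
qed

text \<open>In terms of monomials: \<open>x\<^sup>a\<close> is divisible by a product of \<open>k\<close> edges, that is, \<open>x\<^sup>a\<close> lies
  in the \<open>k\<close>-th power of the edge ideal.\<close>

definition packs :: "('v \<times> 'v) set \<Rightarrow> ('v \<Rightarrow> int) \<Rightarrow> nat \<Rightarrow> bool" where
  "packs E a k \<longleftrightarrow> (\<exists>M. set_mset M \<subseteq> E \<and> size M = k \<and> (\<forall>v. edge_deg M v \<le> a v))"

lemma packsI: "set_mset M \<subseteq> E \<Longrightarrow> size M = k \<Longrightarrow> (\<And>v. edge_deg M v \<le> a v) \<Longrightarrow> packs E a k"
  by (auto simp: packs_def)

lemma packs_0: "(\<And>v. 0 \<le> a v) \<Longrightarrow> packs E a 0"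
  by (rule packsI[of "{#}"]) auto

lemma packs_add:
  assumes "packs E a k" "packs E b l"
  shows "packs E (\<lambda>v. a v + b v) (k + l)"
proof -
  obtain M N where "set_mset M \<subseteq> E" "size M = k" "\<And>v. edge_deg M v \<le> a v"
    "set_mset N \<subseteq> E" "size N = l" "\<And>v. edge_deg N v \<le> b v"
    using assms by (auto simp: packs_def)
  then show ?thesis by (intro packsI[of "M + N"]) (auto intro: add_mono)
qed

lemma packs_Suc_remove:
  assumes "packs E b (Suc k)" "1 \<le> b y"
  shows "packs E (\<lambda>v. b v - of_bool (y = v)) k"
proof -
  from assms(1) obtain M where M: "set_mset M \<subseteq> E" "size M = Suc k" "\<And>v. edge_deg M v \<le> b v"
    by (auto simp: packs_def)
  show ?thesis
  proof (cases "0 < edge_deg M y")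
    case True
    then obtain w e M' where e: "M = add_mset e M'" "e = (y, w) \<or> e = (w, y)"
      by (rule edge_at_vertex)
    have "edge_deg M' v \<le> b v - of_bool (y = v)" for v
      using M(3)[of v] e by (auto simp: of_bool_def split: if_splits)
    then show ?thesis
      using M e by (intro packsI[of M']) auto
  next
    case False
    from M(2) obtain e M' where e: "M = add_mset e M'"
      by (metis size_eq_Suc_imp_eq_union)
    have "edge_deg M' v \<le> b v - of_bool (y = v)" for v
      using M(3)[of v] False assms(2) e edge_deg_nonneg[of M' v]
      by (cases e) (auto simp: of_bool_def split: if_splits)
    then show ?thesis
      using M e by (intro packsI[of M']) auto
  qed
qed

lemma packs_Suc: "packs E a (Suc k) \<Longrightarrow> packs E a k"
proof -
  assume "packs E a (Suc k)"
  then obtain M where M: "set_mset M \<subseteq> E" "size M = Suc k" "\<And>v. edge_deg M v \<le> a v"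
    by (auto simp: packs_def)
  from M(2) obtain e M' where e: "M = add_mset e M'"
    by (metis size_eq_Suc_imp_eq_union)
  have "edge_deg M' v \<le> a v" for v
    using M(3)[of v] e by (cases e) (auto simp: of_bool_def split: if_splits)
  then show ?thesis
    using M e by (intro packsI[of M']) auto
qed

lemma packs_antimono: "packs E a l \<Longrightarrow> k \<le> l \<Longrightarrow> packs E a k"
  by (induction l) (auto dest: packs_Suc simp: le_Suc_eq)

text \<open>Suppose that \<open>k\<close> edges do not fit under \<open>a\<close>, let \<open>r < k\<close> be the largest number that does, and
  say that a packing misses a vertex where its degree is below \<open>a\<close>. Adding an edge \<open>xy\<close> to \<open>a\<close>
  makes room for \<open>r + 2\<close> edges, and a packing of this size has degree \<open>a + 1\<close> at \<open>x\<close> and at \<open>y\<close>.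
  Removing from it an edge at \<open>x\<close> and an edge at \<open>y\<close> leaves \<open>r\<close> edges under \<open>a\<close> that miss some
  neighbour of \<open>x\<close>. Hence every vertex that lies on an edge has a neighbour that is missed by a
  largest packing, and so there is an edge \<open>xy\<close> with both ends of this kind. Let \<open>Mx\<close> and \<open>My\<close>
  be largest packings missing \<open>x\<close> and \<open>y\<close>, and let \<open>N\<close> be a packing of \<open>r + 2\<close> edges under
  \<open>a + x + y\<close>. An exchange at \<open>y\<close> between \<open>Mx\<close> and \<open>N\<close> yields a packing \<open>L\<close> of \<open>r + 1\<close> edges under
  \<open>a + y - x\<close>, and an exchange at \<open>y\<close> between \<open>My\<close> and \<open>L\<close> yields \<open>r + 1\<close> edges under \<open>a\<close>, or
  \<open>r\<close> edges under \<open>a - x - y\<close> to which \<open>xy\<close> can be added. In matching theory the analogous fact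
  is Gallai's lemma on factor-critical graphs.\<close>

lemma packs_colon:
  fixes a :: "'v \<Rightarrow> int"
  assumes "sym E" "irrefl E" "E \<noteq> {}" and nonneg: "\<And>v. 0 \<le> a v"
    and edge: "\<And>x y. (x, y) \<in> E \<Longrightarrow> packs E (\<lambda>v. a v + of_bool (x = v) + of_bool (y = v)) (Suc k)"
  shows "packs E a k"
proof (rule ccontr)
  assume "\<not> packs E a k"
  have "packs E a 0" by (rule packs_0) (rule nonneg)
  obtain r where r: "packs E a r" "\<not> packs E a (Suc r)"
  proof (rule ccontr)
    assume "\<not> thesis"
    then have "packs E a j" for j
      by (induction j) (use that \<open>packs E a 0\<close> in auto)
    with \<open>\<not> packs E a k\<close> show False by blast
  qed
  have "Suc r \<le> k"
    using \<open>\<not> packs E a k\<close> r(1) packs_antimono not_less_eq_eq by blast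
  have edge: "packs E (\<lambda>v. a v + of_bool (x = v) + of_bool (y = v)) (Suc (Suc r))"
    if "(x, y) \<in> E" for x y
    by (rule packs_antimono[OF edge[OF that]]) (use \<open>Suc r \<le> k\<close> in simp)
  have flip: "(y, x) \<in> E" if "(x, y) \<in> E" for x y
    using that assms(1) by (simp add: sym_def)
  have loopless: "x \<noteq> y" if "(x, y) \<in> E" for x y
    using that assms(2) by (auto simp: irrefl_def)
  have one_more: "\<not> packs E (\<lambda>v. a v + of_bool (x = v)) (Suc (Suc r))" for x
  proof
    assume "packs E (\<lambda>v. a v + of_bool (x = v)) (Suc (Suc r))"
    from packs_Suc_remove[OF this, of x] r(2) nonneg[of x] show False by simp
  qed
  have full: "edge_deg N x = a x + 1"
    if "(x, y) \<in> E" "set_mset N \<subseteq> E" "size N = Suc (Suc r)"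
      "\<And>v. edge_deg N v \<le> a v + of_bool (x = v) + of_bool (y = v)" for x y N
  proof (rule ccontr)
    assume "edge_deg N x \<noteq> a x + 1"
    then have "edge_deg N v \<le> a v + of_bool (y = v)" for v
      using that(4)[of v] loopless[OF that(1)] by (auto simp: of_bool_def split: if_splits)
    then have "packs E (\<lambda>v. a v + of_bool (y = v)) (Suc (Suc r))"
      by (rule packsI[OF that(2,3)])
    then show False using one_more by blast
  qed
  have no_free_edge: False
    if "(x, y) \<in> E" "set_mset M \<subseteq> E" "size M = r" "\<And>v. edge_deg M v \<le> a v"
      "edge_deg M x < a x" "edge_deg M y < a y" for x y M
  proof -
    have "edge_deg (add_mset (x, y) M) v \<le> a v" for v
      using that(4)[of v] that(5,6) loopless[OF that(1)] by (auto simp: of_bool_def)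
    then show False
      using r(2) packsI[of "add_mset (x, y) M" E "Suc r" a] that(1-3) by auto
  qed
  have free_neighbour: "\<exists>w. (x, w) \<in> E \<and> packs E (\<lambda>v. a v - of_bool (w = v)) r"
    if xy: "(x, y) \<in> E" for x y
  proof -
    from edge[OF xy] obtain N where N: "set_mset N \<subseteq> E" "size N = Suc (Suc r)"
      "\<And>v. edge_deg N v \<le> a v + of_bool (x = v) + of_bool (y = v)"
      by (auto simp: packs_def)
    have "0 < edge_deg N x" using full[OF xy N] nonneg[of x] by simp
    then obtain w e N1 where e: "N = add_mset e N1" "e = (x, w) \<or> e = (w, x)"
      by (rule edge_at_vertex)
    have "e \<in> E" using N(1) e(1) by auto
    then have xw: "(x, w) \<in> E" using e(2) flip by blast
    have N1: "edge_deg N1 v \<le> a v + of_bool (y = v) - of_bool (w = v)" for v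
      using N(3)[of v] e by (auto simp: of_bool_def split: if_splits)
    have packs_N1: "packs E (\<lambda>v. a v + of_bool (y = v) - of_bool (w = v)) (Suc r)"
      by (rule packsI[of N1]) (use N e N1 in auto)
    have "w \<noteq> y"
      using packs_N1 r(2) by force
    then have "packs E (\<lambda>v. a v - of_bool (w = v)) r"
      using packs_Suc_remove[OF packs_N1, of y] nonneg[of y] by (simp add: algebra_simps)
    with xw show ?thesis by blast
  qed
  obtain x y where xy: "(x, y) \<in> E"
    and "packs E (\<lambda>v. a v - of_bool (x = v)) r" "packs E (\<lambda>v. a v - of_bool (y = v)) r"
  proof -
    obtain p q where "(p, q) \<in> E" using assms(3) by auto
    then obtain w where w: "(p, w) \<in> E" "packs E (\<lambda>v. a v - of_bool (w = v)) r"
      using free_neighbour by blast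
    then have "(w, p) \<in> E" by (simp add: flip)
    then obtain z where "(w, z) \<in> E" "packs E (\<lambda>v. a v - of_bool (z = v)) r"
      using free_neighbour by blast
    with w that show thesis by blast
  qed
  then obtain Mx My where
    Mx: "set_mset Mx \<subseteq> E" "size Mx = r" "\<And>v. edge_deg Mx v \<le> a v - of_bool (x = v)" and
    My: "set_mset My \<subseteq> E" "size My = r" "\<And>v. edge_deg My v \<le> a v - of_bool (y = v)"
    by (auto simp: packs_def)
  from edge[OF xy] obtain N where N: "set_mset N \<subseteq> E" "size N = Suc (Suc r)"
    "\<And>v. edge_deg N v \<le> a v + of_bool (x = v) + of_bool (y = v)"
    by (auto simp: packs_def)
  have [simp]: "x \<noteq> y" "y \<noteq> x" using loopless[OF xy] by auto
  have Ny: "edge_deg N y = a y + 1"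
    by (rule full[OF flip[OF xy] N(1,2)]) (use N(3) in \<open>simp add: add_ac\<close>)
  have Mx_le: "edge_deg Mx v \<le> a v" for v using Mx(3)[of v] by (simp add: of_bool_def split: if_splits)
  have My_le: "edge_deg My v \<le> a v" for v using My(3)[of v] by (simp add: of_bool_def split: if_splits)
  have Mxy: "edge_deg Mx y = a y"
    using no_free_edge[OF xy Mx(1,2) Mx_le] Mx(3)[of x] Mx_le[of y] by force
  have "edge_deg Mx y < edge_deg N y" using Mxy Ny by simp
  from Mx(1) N(1) assms(2) this
  obtain L where L: "set_mset L \<subseteq> E" "size L = Suc r"
    "\<And>v. edge_deg L v \<le> a v + of_bool (y = v) - of_bool (x = v)"
  proof (cases rule: exchange)
    case (join v M' N')
    have "v \<noteq> y" using join(5) Mxy Ny by auto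
    \<comment> \<open>A walk from \<open>y\<close> to \<open>x\<close> would take from \<open>N\<close> exactly the surplus in \<open>x\<close> and \<open>y\<close>.\<close>
    have "v \<noteq> x"
    proof
      assume "v = x"
      then have "edge_deg N' w \<le> a w" for w
        using join(7)[of w] N(3)[of w] by (auto simp: of_bool_def split: if_splits)
      then show False
        using r(2) packsI[OF join(2), of "Suc r" a] join(4) N(2) by simp
    qed
    have "edge_deg M' w \<le> a w + of_bool (y = w) - of_bool (x = w)" for w
      using join(5) join(6)[of w] Mx(3)[of w] N(3)[of w] \<open>v \<noteq> x\<close> \<open>v \<noteq> y\<close>
      by (auto simp: of_bool_def split: if_splits)
    then show thesis using that[of M'] join(1,3) Mx(2) by simp
  next
    case (move v M' N')
    have "edge_deg N' w \<le> a w + of_bool (x = w)" for w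
      using move(5) move(7)[of w] N(3)[of w] Mx_le[of w] Ny
      by (auto simp: of_bool_def split: if_splits)
    then have False
      using one_more[of x] packsI[OF move(2), of "Suc (Suc r)"] move(4) N(2) by simp
    then show thesis ..
  qed
  have Ly: "edge_deg L y = a y + 1"
  proof (rule ccontr)
    assume "edge_deg L y \<noteq> a y + 1"
    then have "edge_deg L v \<le> a v" for v
      using L(3)[of v] by (auto simp: of_bool_def split: if_splits)
    then show False using r(2) packsI[OF L(1,2)] by blast
  qed
  have Myy: "edge_deg My y < a y" using My(3)[of y] by simp
  then have "edge_deg My y < edge_deg L y" using Ly by simp
  from My(1) L(1) assms(2) this show False
  proof (cases rule: exchange)
    case (join v M' N')
    show False
    proof (cases "v = y")
      case True
      \<comment> \<open>The walk is closed, so \<open>N'\<close> has lost two units at \<open>y\<close>; like \<open>L\<close> it misses \<open>x\<close>.\<close>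
      have "edge_deg N' w \<le> a w" "edge_deg N' x < a x" "edge_deg N' y < a y" for w
        using join(7)[of w] join(7)[of x] join(7)[of y] L(3)[of w] L(3)[of x] Ly True
        by (auto simp: of_bool_def split: if_splits)
      then show False
        using no_free_edge[OF xy join(2)] join(4) L(2) by simp
    next
      case False
      have "edge_deg M' w \<le> a w" for w
        using join(5) join(6)[of w] My_le[of w] L(3)[of w] Myy False
        by (auto simp: of_bool_def split: if_splits)
      then show False
        using r(2) packsI[OF join(1)] join(3) My(2) by blast
    qed
  next
    case (move v M' N')
    have "edge_deg N' w \<le> a w" for w
      using move(5) move(7)[of w] L(3)[of w] My_le[of w] Ly
      by (auto simp: of_bool_def split: if_splits)
    then show False
      using r(2) packsI[OF move(2), of "Suc r" a] move(4) L(2) by simp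
  qed
qed


section \<open>Krull dimension and quotients\<close>

lemma (in cring) primeideal_exists:
  assumes "\<one> \<noteq> \<zero>"
  shows "\<exists>P. primeideal P R"
proof -
  let ?A = "{J. ideal J R \<and> \<one> \<notin> J}"
  have "\<exists>U \<in> ?A. \<forall>J \<in> C. J \<subseteq> U" if C: "subset.chain ?A C" for C
  proof -
    let ?U = "if C = {} then {\<zero>} else \<Union>C"
    have "subset.chain {J. ideal J R} C" using C by (auto simp: subset.chain_def)
    then have "ideal ?U R" by (rule chain_Union_is_ideal)
    moreover have "\<one> \<notin> ?U" using C assms by (auto simp: subset.chain_def)
    ultimately show ?thesis by (intro bexI[of _ ?U]) auto
  qed
  from subset_Zorn[OF this] obtain M where M: "M \<in> ?A" and max: "\<And>J. J \<in> ?A \<Longrightarrow> M \<subseteq> J \<Longrightarrow> J = M"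
    by blast
  have "maximalideal M R"
  proof (rule maximalidealI)
    show "ideal M R" "carrier R \<noteq> M" using M one_closed by auto
    fix J assume J: "ideal J R" "M \<subseteq> J" "J \<subseteq> carrier R"
    show "J = M \<or> J = carrier R"
    proof (cases "\<one> \<in> J")
      case True then show ?thesis using ideal.one_imp_carrier[OF J(1)] by simp
    next
      case False then show ?thesis using max[of J] J by simp
    qed
  qed
  then show ?thesis using maximalideal_prime by blast
qed

lemma (in ring_hom_ring) primeideal_vimage:
  assumes "cring R" "primeideal P S"
  shows "primeideal {r \<in> carrier R. h r \<in> P} R"
proof (rule primeidealI)
  interpret P: primeideal P S by fact
  show "ideal {r \<in> carrier R. h r \<in> P} R" by (rule ideal_vimage) (rule P.is_ideal)
  show "cring R" by fact
  show "carrier R \<noteq> {r \<in> carrier R. h r \<in> P}"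
    using P.I_notcarr P.one_imp_carrier by force
  show "a \<in> {r \<in> carrier R. h r \<in> P} \<or> b \<in> {r \<in> carrier R. h r \<in> P}"
    if "a \<in> carrier R" "b \<in> carrier R" "a \<otimes> b \<in> {r \<in> carrier R. h r \<in> P}" for a b
    using that P.I_prime[of "h a" "h b"] by auto
qed

text \<open>Taking preimages under a surjection is injective on primes, so it preserves the lengths of
  chains.\<close>

lemma (in ring_hom_ring) krull_dim_surj:
  assumes "cring R" and surj: "h ` carrier R = carrier S"
  shows "krull_dim S \<le> krull_dim R"
  unfolding krull_dim_def
proof (rule SUP_mono)
  fix C assume C: "C \<in> {C. finite C \<and> C \<noteq> {} \<and> subset.chain {P. primeideal P S} C}"
  let ?v = "\<lambda>P. {r \<in> carrier R. h r \<in> P}"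
  have prime: "primeideal P S" if "P \<in> C" for P using C that by (auto simp: subset.chain_def)
  have carr: "P \<subseteq> carrier S" if "P \<in> C" for P
    using ideal.Icarr[OF primeideal.axioms(1)[OF prime[OF that]]] by blast
  have "h ` ?v P = P" if "P \<in> C" for P
  proof -
    have "P \<subseteq> h ` carrier R" using carr[OF that] surj by simp
    then show ?thesis by auto
  qed
  then have inj: "inj_on ?v C" by (metis (no_types, lifting) inj_onI)
  have "subset.chain {P. primeideal P R} (?v ` C)"
    using C primeideal_vimage[OF assms(1)] prime unfolding subset_chain_def by (auto 0 3)
  then show "\<exists>D \<in> {D. finite D \<and> D \<noteq> {} \<and> subset.chain {P. primeideal P R} D}.
      ereal (real (card C) - 1) \<le> ereal (real (card D) - 1)"
    using C card_image[OF inj] by (intro bexI[of _ "?v ` C"]) auto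
qed

lemma (in cring) krull_dim_Quot_antimono:
  assumes A: "ideal A R" and B: "ideal B R" and AB: "A \<subseteq> B"
  shows "krull_dim (R Quot B) \<le> krull_dim (R Quot A)"
proof -
  interpret A: ideal A R by fact
  interpret B: ideal B R by fact
  let ?h = "\<lambda>K. \<Union>x\<in>K. B +> x"
  have coset: "?h (A +> x) = B +> x" if x: "x \<in> carrier R" for x
  proof -
    have "B +> y = B +> x" if "y \<in> A +> x" for y
    proof -
      have "y \<in> B +> x" using that AB by (auto simp: a_r_coset_def')
      then show ?thesis using B.a_repr_independence' x by simp
    qed
    then have "?h (A +> x) = (\<Union>y \<in> A +> x. B +> x)" by (rule SUP_cong[OF refl])
    also have "\<dots> = B +> x"
      using A.a_rcos_self[OF x] by (intro SUP_eq_const) auto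
    finally show ?thesis .
  qed
  have hom: "ring_hom_ring (R Quot A) (R Quot B) ?h"
  proof (rule ring_hom_ringI)
    show "ring (R Quot A)" "ring (R Quot B)" by (rule A.quotient_is_ring B.quotient_is_ring)+
  next
    fix U V assume "U \<in> carrier (R Quot A)" "V \<in> carrier (R Quot A)"
    then obtain x y where "x \<in> carrier R" "y \<in> carrier R" "U = A +> x" "V = A +> y"
      by (auto simp: FactRing_simps)
    then show "?h (U \<otimes>\<^bsub>R Quot A\<^esub> V) = ?h U \<otimes>\<^bsub>R Quot B\<^esub> ?h V"
      "?h (U \<oplus>\<^bsub>R Quot A\<^esub> V) = ?h U \<oplus>\<^bsub>R Quot B\<^esub> ?h V"
      by (simp_all add: FactRing_simps coset A.rcoset_mult_add B.rcoset_mult_add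
          A.a_rcos_sum B.a_rcos_sum)
  next
    fix U assume "U \<in> carrier (R Quot A)"
    then show "?h U \<in> carrier (R Quot B)" by (auto simp: FactRing_simps coset simp del: UN_iff)
  qed (simp add: FactRing_simps coset)
  show ?thesis
  proof (rule ring_hom_ring.krull_dim_surj[OF hom])
    show "cring (R Quot A)" using A.quotient_is_cring is_cring by blast
    show "?h ` carrier (R Quot A) = carrier (R Quot B)"
      by (auto simp: FactRing_simps coset image_iff simp del: UN_iff)
  qed
qed

text \<open>The supremum of the empty set of chains would be \<open>-\<infinity>\<close>, so the existence of a prime is what
  keeps the dimension of a nonzero ring above that of the zero module.\<close>

lemma (in cring) krull_dim_nonneg:
  assumes "\<one> \<noteq> \<zero>"
  shows "0 \<le> krull_dim R"
proof -
  obtain P where "primeideal P R" using primeideal_exists[OF assms] ..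
  then have "{P} \<in> {C. finite C \<and> C \<noteq> {} \<and> subset.chain {P. primeideal P R} C}"
    by (auto simp: subset.chain_def)
  from SUP_upper[OF this, of "\<lambda>C. ereal (real (card C) - 1)"] show ?thesis
    by (simp add: krull_dim_def zero_ereal_def)
qed

section \<open>Dimension of quotients of ideals\<close>

definition colon :: "('a, 'c) ring_scheme \<Rightarrow> 'a set \<Rightarrow> 'a set \<Rightarrow> 'a set" where
  "colon R L N = {r \<in> carrier R. \<forall>x \<in> N. r \<otimes>\<^bsub>R\<^esub> x \<in> L}"

context cring begin

text \<open>All the cosets in the union that defines the scalar multiplication coincide.\<close>

lemma ideal_quotient_smult:
  assumes "ideal L R" "r \<in> carrier R" "x \<in> carrier R"
  shows "r \<odot>\<^bsub>ideal_quotient R N L\<^esub> (L +> x) = L +> (r \<otimes> x)"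
proof -
  interpret L: ideal L R by fact
  have eq: "L +> (r \<otimes> y) = L +> (r \<otimes> x)" if y: "y \<in> L +> x" for y
  proof -
    obtain l where l: "l \<in> L" "y = l \<oplus> x" using y by (auto simp: a_r_coset_def')
    have "r \<otimes> y = r \<otimes> l \<oplus> r \<otimes> x" using l assms L.Icarr by (simp add: r_distr)
    moreover have "r \<otimes> l \<in> L" using l assms L.I_l_closed by simp
    ultimately have "r \<otimes> y \<in> L +> (r \<otimes> x)" by (auto simp: a_r_coset_def')
    then show ?thesis using L.a_repr_independence' assms by simp
  qed
  have "(\<Union>y \<in> L +> x. L +> (r \<otimes> y)) = (\<Union>y \<in> L +> x. L +> (r \<otimes> x))"
    using eq by (rule SUP_cong[OF refl])
  also have "\<dots> = L +> (r \<otimes> x)"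
    using L.a_rcos_self[OF assms(3)] by (intro SUP_eq_const) auto
  finally show ?thesis by (simp add: ideal_quotient_def)
qed

lemma a_rcos_eq_self_iff:
  assumes "ideal L R" "x \<in> carrier R"
  shows "L +> x = L \<longleftrightarrow> x \<in> L"
proof -
  interpret L: ideal L R by fact
  show ?thesis
    by (rule iffI) (erule a_coset_join1[OF _ assms(2) L.a_subgroup], erule a_coset_join2[OF assms(2) L.a_subgroup])
qed

lemma annihilator_ideal_quotient:
  assumes "ideal L R" "N \<subseteq> carrier R"
  shows "annihilator R (ideal_quotient R N L) = colon R L N"
proof -
  have "(\<forall>m \<in> carrier (ideal_quotient R N L). r \<odot>\<^bsub>ideal_quotient R N L\<^esub> m = \<zero>\<^bsub>ideal_quotient R N L\<^esub>)
      \<longleftrightarrow> (\<forall>x \<in> N. r \<otimes> x \<in> L)" if "r \<in> carrier R" for r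
  proof -
    have "\<zero>\<^bsub>ideal_quotient R N L\<^esub> = L" "carrier (ideal_quotient R N L) = (\<lambda>x. L +> x) ` N"
      by (simp_all add: ideal_quotient_def)
    then show ?thesis
      using that assms by (auto simp: ideal_quotient_smult a_rcos_eq_self_iff subsetD)
  qed
  then show ?thesis by (auto simp: annihilator_def colon_def)
qed

lemma ideal_colon:
  assumes "ideal L R" "N \<subseteq> carrier R"
  shows "ideal (colon R L N) R"
proof -
  interpret L: ideal L R by fact
  have N: "x \<in> carrier R" if "x \<in> N" for x using that assms by auto
  show ?thesis
  proof (rule idealI[OF ring_axioms])
    show "subgroup (colon R L N) (add_monoid R)"
    proof
      fix a b assume "a \<in> colon R L N" "b \<in> colon R L N"
      then show "a \<otimes>\<^bsub>add_monoid R\<^esub> b \<in> colon R L N"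
        using N by (auto simp: colon_def l_distr)
    next
      fix a assume "a \<in> colon R L N"
      then show "inv\<^bsub>add_monoid R\<^esub> a \<in> colon R L N"
        using N by (auto simp: colon_def l_minus a_inv_def[symmetric])
    qed (use N in \<open>auto simp: colon_def\<close>)
  next
    fix a y assume a: "a \<in> colon R L N" and y: "y \<in> carrier R"
    have "y \<otimes> a \<otimes> x \<in> L" if "x \<in> N" for x
    proof -
      have "y \<otimes> (a \<otimes> x) \<in> L" using a y that by (auto simp: colon_def intro: L.I_l_closed)
      then show ?thesis using a y N[OF that] by (simp add: colon_def m_assoc)
    qed
    then show "y \<otimes> a \<in> colon R L N" using a y by (auto simp: colon_def)
    then show "a \<otimes> y \<in> colon R L N" using a y by (simp add: colon_def m_comm)
  qed
qed

lemma module_dim_ideal_quotient: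
  assumes "ideal L R" "N \<subseteq> carrier R" "N \<noteq> {}"
  shows "module_dim R (ideal_quotient R N L) =
    (if N \<subseteq> L then - 1 else krull_dim (R Quot colon R L N))"
proof -
  have "carrier (ideal_quotient R N L) = {\<zero>\<^bsub>ideal_quotient R N L\<^esub>} \<longleftrightarrow> (\<forall>x \<in> N. L +> x = L)"
    using assms(3) by (auto simp: ideal_quotient_def)
  also have "\<dots> \<longleftrightarrow> N \<subseteq> L" using a_rcos_eq_self_iff assms(1,2) by blast
  finally show ?thesis
    by (simp add: module_dim_def annihilator_ideal_quotient[OF assms(1,2)])
qed

text \<open>The annihilator of \<open>N/L\<close> is the colon ideal, so an inclusion of colon ideals is an inclusion
  of annihilators. It also transfers vanishing: \<open>N \<subseteq> L\<close> holds iff \<open>\<one>\<close> lies in the colon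
  ideal. The dimension \<open>- 1\<close> of a zero module lies below that of any nonzero module.\<close>

lemma module_dim_mono_colon:
  assumes L: "ideal L R" and N: "N \<subseteq> carrier R" "N \<noteq> {}"
    and L': "ideal L' R" and N': "N' \<subseteq> carrier R" "N' \<noteq> {}"
    and sub: "colon R L' N' \<subseteq> colon R L N"
  shows "module_dim R (ideal_quotient R N L) \<le> module_dim R (ideal_quotient R N' L')"
proof -
  have one: "N \<subseteq> L \<longleftrightarrow> \<one> \<in> colon R L N" "N' \<subseteq> L' \<longleftrightarrow> \<one> \<in> colon R L' N'"
    using N N' by (auto simp: colon_def subset_eq)
  have nonneg: "0 \<le> krull_dim (R Quot colon R L' N')" if "\<not> N' \<subseteq> L'"
  proof -
    interpret C: ideal "colon R L' N'" R by (rule ideal_colon[OF L' N'(1)])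
    interpret Q: cring "R Quot colon R L' N'" using C.quotient_is_cring is_cring by blast
    have "\<one>\<^bsub>R Quot colon R L' N'\<^esub> \<noteq> \<zero>\<^bsub>R Quot colon R L' N'\<^esub>"
      using that one a_rcos_eq_self_iff[OF C.is_ideal] by (simp add: FactRing_def)
    then show ?thesis by (rule Q.krull_dim_nonneg)
  qed
  have "(-1 :: ereal) \<le> 0" by (simp add: zero_ereal_def one_ereal_def)
  then have ge: "-1 \<le> krull_dim (R Quot colon R L' N')" if "\<not> N' \<subseteq> L'"
    using nonneg[OF that] by (rule order_trans)
  show ?thesis
    using ge one sub krull_dim_Quot_antimono[OF ideal_colon[OF L' N'(1)] ideal_colon[OF L N(1)] sub]
    unfolding module_dim_ideal_quotient[OF L N] module_dim_ideal_quotient[OF L' N']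
    by auto
qed

end


section \<open>Symbolic powers\<close>

text \<open>Subrings of an integral domain that is a type: both the polynomial ring in \<open>n\<close> variables and
  its localizations at primes are of this form.\<close>

locale type_subdomain = domain R for R :: "'a::idom ring" (structure) +
  assumes R_eq: "R = ring_of_type_algebra\<lparr>carrier := carrier R\<rparr>"
begin

lemma type_ops: "x \<otimes> y = x * y" "x \<oplus> y = x + y" "\<one> = 1" "\<zero> = 0"
  by (subst R_eq, simp add: ring_of_type_algebra_def)+

end

lemma type_subdomainI:
  fixes C :: "'a::idom set"
  assumes "1 \<in> C" "\<And>x y. x \<in> C \<Longrightarrow> y \<in> C \<Longrightarrow> x + y \<in> C"
    "\<And>x y. x \<in> C \<Longrightarrow> y \<in> C \<Longrightarrow> x * y \<in> C" "\<And>x. x \<in> C \<Longrightarrow> - x \<in> C"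
  shows "type_subdomain (ring_of_type_algebra\<lparr>carrier := C\<rparr>)"
proof -
  have zero: "0 \<in> C" using assms(2)[OF assms(1) assms(4)[OF assms(1)]] by simp
  have "cring (ring_of_type_algebra\<lparr>carrier := C\<rparr>)"
  proof (rule cringI)
    show "abelian_group (ring_of_type_algebra\<lparr>carrier := C\<rparr>)"
    proof (rule abelian_groupI)
      fix x assume "x \<in> carrier (ring_of_type_algebra\<lparr>carrier := C\<rparr>)"
      then show "\<exists>y\<in>carrier (ring_of_type_algebra\<lparr>carrier := C\<rparr>).
          y \<oplus>\<^bsub>ring_of_type_algebra\<lparr>carrier := C\<rparr>\<^esub> x = \<zero>\<^bsub>ring_of_type_algebra\<lparr>carrier := C\<rparr>\<^esub>"
        using assms(4) by (intro bexI[of _ "- x"]) (auto simp: ring_of_type_algebra_def)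
    qed (use assms zero in \<open>auto simp: ring_of_type_algebra_def add_ac\<close>)
    show "Group.comm_monoid (ring_of_type_algebra\<lparr>carrier := C\<rparr>)"
      by (rule comm_monoidI) (use assms in \<open>auto simp: ring_of_type_algebra_def mult_ac\<close>)
  qed (auto simp: ring_of_type_algebra_def algebra_simps)
  then have "domain (ring_of_type_algebra\<lparr>carrier := C\<rparr>)"
    by (intro domain.intro domain_axioms.intro) (auto simp: ring_of_type_algebra_def)
  then show ?thesis
    by (intro type_subdomain.intro type_subdomain_axioms.intro) (auto simp: ring_of_type_algebra_def)
qed

context cring begin

lemma ideal_power_0: "ideal_power R I 0 = carrier R"
  by (simp add: ideal_power_def ideals_set_def)

lemma ideal_power_Suc: "ideal_power R I (Suc t) = ideal_prod R (ideal_power R I t) I"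
  by (simp add: ideal_power_def) (simp add: ideals_set_def)

lemma ideal_ideal_power: "ideal I R \<Longrightarrow> ideal (ideal_power R I t) R"
  by (induction t) (auto simp: ideal_power_0 ideal_power_Suc oneideal ideal_prod_is_ideal)

end

context type_subdomain begin

lemma localization_subdomain:
  assumes "primeideal P R"
  shows "type_subdomain (localization R P)"
  unfolding localization_def
proof (rule type_subdomainI)
  interpret P: primeideal P R by fact
  have zero: "0 \<in> P" using P.zero_closed type_ops by simp
  have mult: "s * t \<in> carrier R - P" if "s \<in> carrier R - P" "t \<in> carrier R - P" for s t
    using that P.I_prime[of s t] m_closed[of s t] by (auto simp: type_ops)
  have add: "a + b \<in> carrier R" if "a \<in> carrier R" "b \<in> carrier R" for a b
    using that a_closed[of a b] by (simp add: type_ops)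
  have times: "a * b \<in> carrier R" if "a \<in> carrier R" "b \<in> carrier R" for a b
    using that m_closed[of a b] by (simp add: type_ops)
  have minus: "- a \<in> carrier R" if "a \<in> carrier R" for a
  proof -
    have "\<ominus> a + a = 0" using l_neg[OF that] by (simp add: type_ops)
    then have "- a = \<ominus> a" by (metis eq_neg_iff_add_eq_0)
    then show ?thesis using that by simp
  qed
  let ?L = "{Fract a s |a s. a \<in> carrier R \<and> s \<in> carrier R - P}"
  have one: "1 \<in> carrier R - P"
    using P.I_notcarr P.one_imp_carrier one_closed by (auto simp: type_ops)
  then show "1 \<in> ?L" by (auto simp: One_fract_def)
  show "x + y \<in> ?L" "x * y \<in> ?L" if xy: "x \<in> ?L" "y \<in> ?L" for x y
  proof -
    obtain a s b t where *: "x = Fract a s" "y = Fract b t" "a \<in> carrier R" "b \<in> carrier R"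
      "s \<in> carrier R - P" "t \<in> carrier R - P" using xy by auto
    have "s \<noteq> 0" "t \<noteq> 0" using * zero by auto
    then have sum: "x + y = Fract (a * t + b * s) (s * t)" and prod: "x * y = Fract (a * b) (s * t)"
      using * by simp_all
    have in_L: "Fract c (s * t) \<in> ?L" if "c \<in> carrier R" for c
    proof -
      have "\<exists>a u. Fract c (s * t) = Fract a u \<and> a \<in> carrier R \<and> u \<in> carrier R - P"
        by (rule exI[of _ c], rule exI[of _ "s * t"]) (use that mult[OF *(5,6)] in simp)
      then show ?thesis by simp
    qed
    show "x + y \<in> ?L" unfolding sum by (rule in_L[OF add[OF times times]]) (use *(3-6) in simp_all)
    show "x * y \<in> ?L" unfolding prod by (rule in_L[OF times]) (use *(3-6) in simp_all)
  qed
  show "- x \<in> ?L" if xL: "x \<in> ?L" for x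
  proof -
    obtain a s where "x = Fract a s" "a \<in> carrier R" "s \<in> carrier R - P" using xL by auto
    then have "- x = Fract (- a) s \<and> - a \<in> carrier R \<and> s \<in> carrier R - P"
      by (simp add: minus)
    then show ?thesis by blast
  qed
qed

lemma Fract_in_localization:
  assumes "primeideal P R" "a \<in> carrier R"
  shows "Fract a 1 \<in> carrier (localization R P)"
proof -
  interpret P: primeideal P R by fact
  have "1 \<in> carrier R - P"
    using P.I_notcarr P.one_imp_carrier one_closed by (auto simp: type_ops)
  then show ?thesis using assms(2) by (auto simp: localization_def)
qed

lemma ideal_extension:
  assumes "primeideal P R" "J \<subseteq> carrier R"
  shows "ideal (extension R P J) (localization R P)"
proof -
  interpret L: type_subdomain "localization R P" by (rule localization_subdomain) fact
  show ?thesis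
    unfolding extension_def
    using assms by (intro L.genideal_ideal) (auto simp: Fract_in_localization)
qed

text \<open>The fractions \<open>z\<close> with \<open>z * e \<in> K R\<^sub>P\<close> form an ideal, which contains \<open>J\<close> and hence \<open>J R\<^sub>P\<close>.\<close>

lemma extension_times:
  assumes P: "primeideal P R" and J: "J \<subseteq> carrier R" and K: "K \<subseteq> carrier R"
    and e: "e \<in> carrier R" and JK: "\<And>a. a \<in> J \<Longrightarrow> a * e \<in> K"
    and z: "z \<in> extension R P J"
  shows "z * Fract e 1 \<in> extension R P K"
proof -
  interpret L: type_subdomain "localization R P" by (rule localization_subdomain) fact
  interpret K: ideal "extension R P K" "localization R P" by (rule ideal_extension[OF P K])
  let ?Z = "{z \<in> carrier (localization R P). z * Fract e 1 \<in> extension R P K}"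
  have ext: "Fract b 1 \<in> extension R P K" if "b \<in> K" for b
  proof -
    have "(\<lambda>a. Fract a 1) ` K \<subseteq> extension R P K"
      unfolding extension_def using K Fract_in_localization[OF P] by (intro L.genideal_self) auto
    then show ?thesis using that by blast
  qed
  have "?Z = colon (localization R P) (extension R P K) {Fract e 1}"
    by (auto simp: colon_def L.type_ops)
  moreover have "ideal (colon (localization R P) (extension R P K) {Fract e 1}) (localization R P)"
    by (rule L.ideal_colon) (use K.is_ideal Fract_in_localization[OF P e] in auto)
  ultimately have "ideal ?Z (localization R P)" by simp
  moreover have "(\<lambda>a. Fract a 1) ` J \<subseteq> ?Z"
    using J JK ext Fract_in_localization[OF P] by auto
  ultimately have "extension R P J \<subseteq> ?Z"
    unfolding extension_def[of R P J] by (rule L.genideal_minimal)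
  with z show ?thesis by auto
qed

lemma symbolic_power_mult:
  assumes I: "ideal I R" and g: "g \<in> symbolic_power R I t" and e: "e \<in> I"
  shows "g \<otimes> e \<in> symbolic_power R I (Suc t)"
proof -
  interpret I: ideal I R by fact
  have e': "e \<in> carrier R" using e by (rule I.Icarr)
  have g': "g \<in> carrier R" using g by (simp add: symbolic_power_def)
  have carr: "ideal_power R I s \<subseteq> carrier R" for s
    using ideal.Icarr[OF ideal_ideal_power[OF I]] by blast
  have "Fract (g * e) 1 \<in> extension R P (ideal_power R I (Suc t))"
    if P: "P \<in> associated_primes R (ideal_quotient R (carrier R) I)" for P
  proof -
    have "primeideal P R" using P by (simp add: associated_primes_def)
    moreover have "a * e \<in> ideal_power R I (Suc t)" if "a \<in> ideal_power R I t" for a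
      using ideal_prod.prod[OF that e, of R] by (simp add: ideal_power_Suc type_ops)
    moreover have "Fract g 1 \<in> extension R P (ideal_power R I t)"
      using g P by (auto simp: symbolic_power_def contraction_def)
    ultimately have "Fract g 1 * Fract e 1 \<in> extension R P (ideal_power R I (Suc t))"
      using extension_times carr e' by blast
    then show ?thesis by simp
  qed
  then show ?thesis
    using g' e' m_closed[OF g' e'] by (auto simp: symbolic_power_def contraction_def type_ops)
qed

lemma zero_in_symbolic_power:
  assumes I: "ideal I R"
  shows "\<zero> \<in> symbolic_power R I t"
proof -
  have "Fract 0 1 \<in> extension R P (ideal_power R I t)"
    if "P \<in> associated_primes R (ideal_quotient R (carrier R) I)" for P
  proof -
    have P: "primeideal P R" using that by (simp add: associated_primes_def)
    interpret L: type_subdomain "localization R P" by (rule localization_subdomain[OF P])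
    interpret E: ideal "extension R P (ideal_power R I t)" "localization R P"
      using ideal.Icarr[OF ideal_ideal_power[OF I]] by (intro ideal_extension[OF P]) blast
    show ?thesis using E.zero_closed by (simp add: L.type_ops Zero_fract_def)
  qed
  then show ?thesis using zero_closed by (simp add: symbolic_power_def contraction_def type_ops)
qed

text \<open>The zero ideal is an associated prime of the domain \<open>R\<close>, and in the localization
  there, a field of fractions that contains \<open>R\<close>, the zero ideal contracts to zero.\<close>

lemma symbolic_power_zero_ideal: "symbolic_power R {\<zero>} t \<subseteq> ideal_power R {\<zero>} t"
proof (cases t)
  case 0
  then show ?thesis by (auto simp: ideal_power_0 symbolic_power_def)
next
  case (Suc s)
  have "ideal_power R {\<zero>} t \<subseteq> {\<zero>}"
    unfolding Suc ideal_power_Suc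
    using ideal_prod_inter[OF ideal_ideal_power[OF zeroideal] zeroideal] by blast
  moreover have "\<zero> \<in> ideal_power R {\<zero>} t"
    using additive_subgroup.zero_closed[OF ideal.axioms(1)[OF ideal_ideal_power[OF zeroideal]]] .
  ultimately have pow: "ideal_power R {\<zero>} t = {\<zero>}" by blast
  have P: "primeideal {\<zero>} R" by (rule zeroprimeideal)
  interpret L: type_subdomain "localization R {\<zero>}" by (rule localization_subdomain[OF P])
  have "{\<zero>} = {r \<in> carrier R. r \<odot>\<^bsub>ideal_quotient R (carrier R) {\<zero>}\<^esub> ({\<zero>} +> \<one>)
      = \<zero>\<^bsub>ideal_quotient R (carrier R) {\<zero>}\<^esub>}"
    using ideal_quotient_smult[OF zeroideal _ one_closed, of _ "carrier R"]
      a_rcos_eq_self_iff[OF zeroideal]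
    by (auto simp: ideal_quotient_def)
  moreover have "{\<zero>} +> \<one> \<in> carrier (ideal_quotient R (carrier R) {\<zero>})"
    by (simp add: ideal_quotient_def)
  ultimately have "{\<zero>} \<in> associated_primes R (ideal_quotient R (carrier R) {\<zero>})"
    using P unfolding associated_primes_def by blast
  moreover have "extension R {\<zero>} {\<zero>} = {0}"
  proof -
    have "Fract \<zero> 1 = 0" by (simp add: type_ops Zero_fract_def)
    then show ?thesis using L.genideal_zero by (simp add: extension_def L.type_ops)
  qed
  ultimately have "symbolic_power R {\<zero>} t \<subseteq> {a. Fract a 1 = 0}"
    by (auto simp: symbolic_power_def contraction_def pow)
  then show ?thesis unfolding pow by (auto simp: Zero_fract_def eq_fract type_ops)
qed

text \<open>If \<open>r\<close> annihilates \<open>I\<^sup>(\<^sup>t\<^sup>+\<^sup>1\<^sup>) / I\<^sup>t\<^sup>+\<^sup>1\<close> and \<open>g \<in> I\<^sup>(\<^sup>t\<^sup>)\<close>, then \<open>g I \<subseteq> I\<^sup>(\<^sup>t\<^sup>+\<^sup>1\<^sup>)\<close> gives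
  \<open>r g I \<subseteq> I\<^sup>t\<^sup>+\<^sup>1\<close>, and cancelling \<open>I\<close> gives \<open>r g \<in> I\<^sup>t\<close>.\<close>

lemma module_dim_symbolic_step:
  assumes I: "ideal I R" and colon: "colon R (ideal_power R I (Suc t)) I \<subseteq> ideal_power R I t"
  shows "module_dim R (ideal_quotient R (symbolic_power R I t) (ideal_power R I t))
    \<le> module_dim R (ideal_quotient R (symbolic_power R I (Suc t)) (ideal_power R I (Suc t)))"
proof (rule module_dim_mono_colon)
  show "ideal (ideal_power R I t) R" "ideal (ideal_power R I (Suc t)) R"
    by (rule ideal_ideal_power[OF I])+
  show "symbolic_power R I t \<noteq> {}" "symbolic_power R I (Suc t) \<noteq> {}"
    using zero_in_symbolic_power[OF I] by blast+
  show sub: "symbolic_power R I t \<subseteq> carrier R" "symbolic_power R I (Suc t) \<subseteq> carrier R"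
    by (auto simp: symbolic_power_def)
  interpret I: ideal I R by fact
  show "colon R (ideal_power R I (Suc t)) (symbolic_power R I (Suc t))
      \<subseteq> colon R (ideal_power R I t) (symbolic_power R I t)"
  proof
    fix r assume r: "r \<in> colon R (ideal_power R I (Suc t)) (symbolic_power R I (Suc t))"
    then have r': "r \<in> carrier R" by (simp add: colon_def)
    have "r \<otimes> g \<in> ideal_power R I t" if g: "g \<in> symbolic_power R I t" for g
    proof -
      have g': "g \<in> carrier R" using g sub by blast
      have "r \<otimes> g \<otimes> e \<in> ideal_power R I (Suc t)" if e: "e \<in> I" for e
        using r symbolic_power_mult[OF I g e] m_assoc[OF r' g' I.Icarr[OF e]]
        by (simp add: colon_def)
      then show ?thesis using colon r' g' by (auto simp: colon_def)
    qed
    then show "r \<in> colon R (ideal_power R I t) (symbolic_power R I t)"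
      using r' by (simp add: colon_def)
  qed
qed

lemma module_dim_symbolic_zero_ideal:
  "module_dim R (ideal_quotient R (symbolic_power R {\<zero>} t) (ideal_power R {\<zero>} t)) = - 1"
proof -
  have "symbolic_power R {\<zero>} t \<subseteq> carrier R" by (auto simp: symbolic_power_def)
  then show ?thesis
    using module_dim_ideal_quotient[OF ideal_ideal_power[OF zeroideal]]
      zero_in_symbolic_power[OF zeroideal] symbolic_power_zero_ideal
    by (metis empty_iff)
qed

end

section \<open>Powers of edge ideals as monomial ideals\<close>

lemma mpoly_ring_subdomain: "type_subdomain (mpoly_ring n :: 'k::field mpoly ring)"
  unfolding mpoly_ring_def
proof (rule type_subdomainI)
  let ?C = "{p :: 'k mpoly. \<forall>m \<in> Poly_Mapping.keys p. Poly_Mapping.keys m \<subseteq> {1..n}}"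
  show "1 \<in> ?C" by simp
  show "x + y \<in> ?C" if "x \<in> ?C" "y \<in> ?C" for x y
    using that keys_add[of x y] by blast
  show "- x \<in> ?C" if "x \<in> ?C" for x
    using that by (auto simp: in_keys_iff)
  show "x * y \<in> ?C" if "x \<in> ?C" "y \<in> ?C" for x y
  proof safe
    fix m i assume "m \<in> Poly_Mapping.keys (x * y)" "i \<in> Poly_Mapping.keys m"
    then obtain a b where "m = a + b" "a \<in> Poly_Mapping.keys x" "b \<in> Poly_Mapping.keys y"
      using keys_mult[of x y] by blast
    moreover have "i \<in> Poly_Mapping.keys a \<union> Poly_Mapping.keys b"
      using keys_add[of a b] \<open>i \<in> Poly_Mapping.keys m\<close> \<open>m = a + b\<close> by blast
    ultimately show "i \<in> {1..n}" using that by blast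
  qed
qed

lemma sum_monomials: "(\<Sum>m\<in>Poly_Mapping.keys p. Poly_Mapping.single m (Poly_Mapping.lookup p m)) = p"
  by (rule poly_mapping_eqI)
    (auto simp: lookup_sum lookup_single when_def sum.delta in_keys_iff)

lemma lookup_times_monomial:
  fixes f :: "'k::field mpoly"
  shows "Poly_Mapping.lookup (f * Poly_Mapping.single e 1) (m + e) = Poly_Mapping.lookup f m"
proof -
  have "(\<Sum>q. Poly_Mapping.lookup (Poly_Mapping.single e (1::'k)) q when m + e = l + q) = (1 when l = m)"
    for l
  proof -
    have "(\<lambda>q. Poly_Mapping.lookup (Poly_Mapping.single e (1::'k)) q when m + e = l + q)
      = (\<lambda>q. (1 when l = m) when q = e)"
      by (auto simp: lookup_single when_def fun_eq_iff)
    then show ?thesis by (simp only: Sum_any_when_equal)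
  qed
  then show ?thesis by (simp add: lookup_mult mult_when)
qed

abbreviation mon_deg :: "(nat \<Rightarrow>\<^sub>0 nat) \<Rightarrow> nat \<Rightarrow> int" where
  "mon_deg m \<equiv> \<lambda>v. int (Poly_Mapping.lookup m v)"

lemma carrier_mpoly_ring:
  "carrier (mpoly_ring n) = {p. \<forall>m \<in> Poly_Mapping.keys p. Poly_Mapping.keys m \<subseteq> {1..n}}"
  by (simp add: mpoly_ring_def)

definition packing_ideal :: "nat \<Rightarrow> (nat \<times> nat) set \<Rightarrow> nat \<Rightarrow> 'k::field mpoly set" where
  "packing_ideal n E k =
    {p \<in> carrier (mpoly_ring n). \<forall>m \<in> Poly_Mapping.keys p. packs E (mon_deg m) k}"

definition edge_monom :: "nat \<Rightarrow> nat \<Rightarrow> nat \<Rightarrow>\<^sub>0 nat" where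
  "edge_monom i j = Poly_Mapping.single i 1 + Poly_Mapping.single j 1"

lemma indet_times: "indet i * indet j = Poly_Mapping.single (edge_monom i j) 1"
  by (simp add: indet_def mult_single edge_monom_def)

lemma lookup_edge_monom:
  "Poly_Mapping.lookup (edge_monom i j) v = of_bool (i = v) + of_bool (j = v)"
  by (simp add: edge_monom_def lookup_add lookup_single when_def)

lemma packing_ideal_times:
  assumes "p \<in> packing_ideal n E k" "q \<in> packing_ideal n E l"
  shows "p * q \<in> (packing_ideal n E (k + l) :: 'k::field mpoly set)"
proof -
  interpret type_subdomain "mpoly_ring n :: 'k mpoly ring" by (rule mpoly_ring_subdomain)
  have "p * q \<in> carrier (mpoly_ring n)"
    using assms m_closed[of p q] by (simp add: packing_ideal_def type_ops)
  moreover have "packs E (mon_deg m) (k + l)" if "m \<in> Poly_Mapping.keys (p * q)" for m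
  proof -
    obtain a b where m: "m = a + b" "a \<in> Poly_Mapping.keys p" "b \<in> Poly_Mapping.keys q"
      using \<open>m \<in> Poly_Mapping.keys (p * q)\<close> keys_mult[of p q] by blast
    then have "packs E (\<lambda>v. mon_deg a v + mon_deg b v) (k + l)"
      using assms by (intro packs_add) (auto simp: packing_ideal_def)
    then show ?thesis by (simp add: m lookup_add)
  qed
  ultimately show ?thesis by (simp add: packing_ideal_def)
qed

lemma packing_ideal_add:
  assumes "p \<in> packing_ideal n E k" "q \<in> packing_ideal n E k"
  shows "p + q \<in> (packing_ideal n E k :: 'k::field mpoly set)"
proof -
  interpret type_subdomain "mpoly_ring n :: 'k mpoly ring" by (rule mpoly_ring_subdomain)
  have "p + q \<in> carrier (mpoly_ring n)"
    using assms a_closed[of p q] by (simp add: packing_ideal_def type_ops)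
  then show ?thesis
    using assms keys_add[of p q] by (auto simp: packing_ideal_def)
qed

lemma packing_ideal_0: "packing_ideal n E 0 = carrier (mpoly_ring n)"
  by (auto simp: packing_ideal_def packs_0)

lemma ideal_packing_ideal: "ideal (packing_ideal n E k) (mpoly_ring n :: 'k::field mpoly ring)"
proof -
  interpret type_subdomain "mpoly_ring n :: 'k mpoly ring" by (rule mpoly_ring_subdomain)
  have times: "p * q \<in> packing_ideal n E k" 
    if "p \<in> packing_ideal n E k" "q \<in> carrier (mpoly_ring n)" for p q :: "'k mpoly"
    using packing_ideal_times[OF that(1), of q 0] that(2) by (simp add: packing_ideal_0)
  show ?thesis
  proof (rule idealI[OF ring_axioms])
    show "subgroup (packing_ideal n E k) (add_monoid (mpoly_ring n :: 'k mpoly ring))"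
    proof (rule add.subgroupI)
      show "packing_ideal n E k \<noteq> ({} :: 'k mpoly set)"
      proof -
        have "(0 :: 'k mpoly) \<in> packing_ideal n E k"
          using zero_closed by (simp add: packing_ideal_def type_ops)
        then show ?thesis by blast
      qed
      show "\<ominus>\<^bsub>mpoly_ring n\<^esub> p \<in> packing_ideal n E k" if "p \<in> packing_ideal n E k" for p :: "'k mpoly"
      proof -
        have p: "p \<in> carrier (mpoly_ring n)" using that by (simp add: packing_ideal_def)
        have "p * (\<ominus>\<^bsub>mpoly_ring n\<^esub> 1) \<in> packing_ideal n E k"
          using times[OF that] one_closed by (simp add: type_ops)
        then show ?thesis using p r_minus[OF p one_closed] by (simp add: type_ops)
      qed
    next
      fix p q :: "'k mpoly" assume "p \<in> packing_ideal n E k" "q \<in> packing_ideal n E k"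
      then show "p \<oplus>\<^bsub>mpoly_ring n\<^esub> q \<in> packing_ideal n E k"
        by (simp add: type_ops packing_ideal_add)
    qed (auto simp: packing_ideal_def)
  qed (use times in \<open>auto simp: type_ops mult.commute\<close>)
qed

locale edge_set =
  fixes n :: nat and E :: "(nat \<times> nat) set" and I :: "'k::field mpoly set"
  assumes E_sub: "E \<subseteq> {1..n} \<times> {1..n}"
    and I_def: "I = genideal (mpoly_ring n) {indet i * indet j | i j. (i, j) \<in> E}"
begin

sublocale type_subdomain "mpoly_ring n :: 'k mpoly ring" by (rule mpoly_ring_subdomain)

lemma edge_in_carrier: "(i, j) \<in> E \<Longrightarrow> indet i * indet j \<in> carrier (mpoly_ring n :: 'k mpoly ring)"
  using E_sub by (auto simp: carrier_mpoly_ring indet_times edge_monom_def in_keys_iff lookup_add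
      lookup_single when_def split: if_splits)

lemma ideal_I: "ideal I (mpoly_ring n)"
  unfolding I_def using edge_in_carrier by (intro genideal_ideal) auto

lemma edge_in_I: "(i, j) \<in> E \<Longrightarrow> indet i * indet j \<in> I"
  unfolding I_def
  using genideal_self[of "{indet i * indet j | i j. (i, j) \<in> E}"] edge_in_carrier by blast

lemma I_sub: "I \<subseteq> packing_ideal n E 1"
  unfolding I_def
proof (rule genideal_minimal[OF ideal_packing_ideal])
  have "packs E (mon_deg (edge_monom i j)) 1" if "(i, j) \<in> E" for i j
    by (rule packsI[of "{#(i, j)#}"]) (use that in \<open>auto simp: lookup_edge_monom\<close>)
  then show "{indet i * indet j | i j. (i, j) \<in> E} \<subseteq> (packing_ideal n E 1 :: 'k mpoly set)"
    using edge_in_carrier by (auto simp: packing_ideal_def) (simp add: indet_times)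
qed

text \<open>A monomial divisible by a product of \<open>t + 1\<close> edges splits off one edge and leaves a monomial
  divisible by a product of \<open>t\<close> edges, and a polynomial is the sum of its terms.\<close>

lemma ideal_power_eq: "ideal_power (mpoly_ring n) I t = packing_ideal n E t"
proof (induction t)
  case 0
  show ?case by (simp add: ideal_power_0 packing_ideal_0)
next
  case (Suc t)
  interpret J: ideal "ideal_power (mpoly_ring n) I (Suc t)" "mpoly_ring n"
    by (rule ideal_ideal_power[OF ideal_I])
  show ?case
  proof
    show "ideal_power (mpoly_ring n) I (Suc t) \<subseteq> packing_ideal n E (Suc t)"
    proof
      fix p assume "p \<in> ideal_power (mpoly_ring n) I (Suc t)"
      then have "p \<in> ideal_prod (mpoly_ring n) (packing_ideal n E t) I"
        by (simp add: ideal_power_Suc Suc.IH)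
      then show "p \<in> packing_ideal n E (Suc t)"
      proof (induction rule: ideal_prod.induct)
        case (prod i j)
        then show ?case using packing_ideal_times[of i n E t j 1] I_sub by (auto simp: type_ops)
      next
        case (sum s1 s2)
        then show ?case by (simp add: type_ops packing_ideal_add)
      qed
    qed
  next
    have monomial: "Poly_Mapping.single m c \<in> ideal_power (mpoly_ring n) I (Suc t)"
      if m: "packs E (mon_deg m) (Suc t)" and vars: "Poly_Mapping.keys m \<subseteq> {1..n}" for m and c :: 'k
    proof -
      obtain M where M: "set_mset M \<subseteq> E" "size M = Suc t" "\<And>v. edge_deg M v \<le> mon_deg m v"
        using m by (auto simp: packs_def)
      obtain x y M' where e: "M = add_mset (x, y) M'"
        using M(2) by (metis size_eq_Suc_imp_eq_union surj_pair)
      have xy: "(x, y) \<in> E" using M(1) e by auto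
      define m' where "m' = m - edge_monom x y"
      have le: "of_bool (x = v) + of_bool (y = v) + edge_deg M' v \<le> mon_deg m v" for v
        using M(3)[of v] e by simp
      have lookup_m': "mon_deg m' v = mon_deg m v - of_bool (x = v) - of_bool (y = v)" for v
      proof -
        have "of_bool (x = v) + of_bool (y = v) \<le> mon_deg m v"
          using le[of v] edge_deg_nonneg[of M' v] by linarith
        then have "Poly_Mapping.lookup (edge_monom x y) v \<le> Poly_Mapping.lookup m v"
          unfolding lookup_edge_monom by (simp add: of_bool_def split: if_splits)
        then show ?thesis by (simp add: m'_def lookup_minus of_nat_diff lookup_edge_monom)
      qed
      have "m = m' + edge_monom x y"
      proof (rule poly_mapping_eqI)
        show "Poly_Mapping.lookup m v = Poly_Mapping.lookup (m' + edge_monom x y) v" for v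
          using lookup_m'[of v] by (simp add: lookup_add lookup_edge_monom of_bool_def split: if_splits)
      qed
      then have "Poly_Mapping.single m c = Poly_Mapping.single m' c * (indet x * indet y)"
        by (simp add: indet_times mult_single)
      moreover have "packs E (mon_deg m') t"
      proof (rule packsI)
        show "edge_deg M' v \<le> mon_deg m' v" for v using le[of v] lookup_m'[of v] by simp
      qed (use M e in auto)
      moreover have "Poly_Mapping.keys m' \<subseteq> Poly_Mapping.keys m"
        by (auto simp: in_keys_iff m'_def lookup_minus)
      ultimately have "Poly_Mapping.single m' c \<in> packing_ideal n E t"
        and eq: "Poly_Mapping.single m c = Poly_Mapping.single m' c * (indet x * indet y)"
        using vars by (auto simp: packing_ideal_def carrier_mpoly_ring)
      then have "Poly_Mapping.single m' c \<otimes>\<^bsub>mpoly_ring n\<^esub> (indet x * indet y)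
          \<in> ideal_power (mpoly_ring n) I (Suc t)"
        unfolding ideal_power_Suc Suc.IH by (intro ideal_prod.prod edge_in_I[OF xy])
      then show ?thesis by (simp add: eq type_ops)
    qed
    show "packing_ideal n E (Suc t) \<subseteq> ideal_power (mpoly_ring n) I (Suc t)"
    proof
      fix p :: "'k mpoly" assume p: "p \<in> packing_ideal n E (Suc t)"
      have "sum f A \<in> ideal_power (mpoly_ring n) I (Suc t)"
        if "\<And>m. m \<in> A \<Longrightarrow> f m \<in> ideal_power (mpoly_ring n) I (Suc t)" "finite A"
        for f :: "(nat \<Rightarrow>\<^sub>0 nat) \<Rightarrow> 'k mpoly" and A
        using that(2,1)
        by (induction A) (use J.zero_closed J.a_closed in \<open>auto simp: type_ops\<close>)
      then have "(\<Sum>m\<in>Poly_Mapping.keys p. Poly_Mapping.single m (Poly_Mapping.lookup p m))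
          \<in> ideal_power (mpoly_ring n) I (Suc t)"
        using p monomial by (auto simp: packing_ideal_def carrier_mpoly_ring)
      then show "p \<in> ideal_power (mpoly_ring n) I (Suc t)" by (simp add: sum_monomials)
    qed
  qed
qed

text \<open>The substantial half of \<open>(I\<^sup>t\<^sup>+\<^sup>1 : I) = I\<^sup>t\<close>. Multiplication by an edge translates the set of
  monomials of a polynomial, so the claim concerns single monomials, where it is
  \<open>packs_colon\<close>.\<close>

lemma colon_ideal_power:
  assumes "sym E" "irrefl E" "E \<noteq> {}"
  shows "colon (mpoly_ring n) (ideal_power (mpoly_ring n) I (Suc t)) I
    \<subseteq> ideal_power (mpoly_ring n) I t"
proof
  fix f assume f: "f \<in> colon (mpoly_ring n) (ideal_power (mpoly_ring n) I (Suc t)) I"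
  have "packs E (mon_deg m) t" if m: "m \<in> Poly_Mapping.keys f" for m
  proof (rule packs_colon[OF assms])
    fix x y assume xy: "(x, y) \<in> E"
    have "f * Poly_Mapping.single (edge_monom x y) 1 \<in> packing_ideal n E (Suc t)"
      using f edge_in_I[OF xy] by (auto simp: colon_def type_ops ideal_power_eq indet_times)
    moreover have "m + edge_monom x y \<in> Poly_Mapping.keys (f * Poly_Mapping.single (edge_monom x y) 1)"
      using m by (simp add: in_keys_iff lookup_times_monomial)
    ultimately have "packs E (mon_deg (m + edge_monom x y)) (Suc t)"
      by (auto simp: packing_ideal_def)
    then show "packs E (\<lambda>v. mon_deg m v + of_bool (x = v) + of_bool (y = v)) (Suc t)"
      by (simp add: lookup_add lookup_edge_monom add.assoc)
  qed simp
  then show "f \<in> ideal_power (mpoly_ring n) I t"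
    using f by (auto simp: ideal_power_eq packing_ideal_def colon_def)
qed

end

section \<open>Monotonicity of the dimension\<close>

theorem corollary7p8:
  fixes n :: nat and G :: "nat pair_pre_digraph"
  assumes "pair_graph G" and "pverts G = {1..n}" and "connected (with_proj G)"
  shows "let S = mpoly_ring n :: 'k::field mpoly ring;
             I = edge_ideal n G
         in mono_on {1..} (\<lambda>t. module_dim S
              (ideal_quotient S (symbolic_power S I t) (ideal_power S I t)))"
proof -
  interpret G: pair_graph G by fact
  let ?S = "mpoly_ring n :: 'k mpoly ring" and ?I = "edge_ideal n G :: 'k mpoly set"
  interpret edge_set n "parcs G" ?I
    by unfold_locales (use assms(2) G.in_arcsD1 G.in_arcsD2 in \<open>auto simp: edge_ideal_def\<close>)
  let ?d = "\<lambda>t. module_dim ?S (ideal_quotient ?S (symbolic_power ?S ?I t) (ideal_power ?S ?I t))"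
  have "?d t \<le> ?d (Suc t)" for t
  proof (cases "parcs G = {}")
    case True
    \<comment> \<open>Without edges \<open>I\<close> is zero and cannot be cancelled, but all the modules vanish.\<close>
    have "?I \<subseteq> {\<zero>\<^bsub>?S\<^esub>}"
      unfolding edge_ideal_def by (rule genideal_minimal[OF zeroideal]) (simp add: True)
    moreover have "\<zero>\<^bsub>?S\<^esub> \<in> ?I"
      using additive_subgroup.zero_closed[OF ideal.axioms(1)[OF ideal_I]] .
    ultimately have "?I = {\<zero>\<^bsub>?S\<^esub>}" by blast
    then show ?thesis by (simp add: module_dim_symbolic_zero_ideal)
  next
    case False
    have "sym (parcs G)" by (auto simp: sym_def intro: G.arcs_symmetric)
    moreover have "irrefl (parcs G)" using G.no_loops' by (auto simp: irrefl_def)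
    ultimately show ?thesis
      using False by (intro module_dim_symbolic_step ideal_I colon_ideal_power)
  qed
  then have "mono ?d" by (rule mono_iff_le_Suc[THEN iffD2, rule_format])
  then show ?thesis by (simp add: Let_def mono_on_def monoD)
qed

end
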